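(* Let $G$ be a finite simple $r$-regular graph with $r \geq 2$, and let $q \geq 3$. Then for every integer $p \geq 0$, \[ \alpha_p(G) \leq \alpha_q(L(G)). \]
   Context: For a graph $G$ and a non-negative integer $p$, a set $S \subseteq V(G)$ is $p$-independent if the subgraph induced by $S$ has maximum degree at most $p$; $\alpha_p(G)$ denotes the maximum cardinality of a $p$-independent set of $G$. $L(G)$ is the line graph of $G$. *)

theory Defs
  imports Main
begin

record 'a ugraph =
  verts :: "'a set"
  edges :: "'a set set"

definition simple_graph :: "'a ugraph \<Rightarrow> bool" where
  "simple_graph G \<longleftrightarrow> (\<forall>e \<in> edges G. e \<subseteq> verts G \<and> card e = 2)"

definition finite_simple_graph :: "'a ugraph \<Rightarrow> bool" where
  "finite_simple_graph G \<longleftrightarrow> finite (verts G) \<and> simple_graph G"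

definition degree :: "'a ugraph \<Rightarrow> 'a \<Rightarrow> nat" where
  "degree G v = card {e \<in> edges G. v \<in> e}"

definition regular :: "nat \<Rightarrow> 'a ugraph \<Rightarrow> bool" where
  "regular r G \<longleftrightarrow> (\<forall>v \<in> verts G. degree G v = r)"

(* Inserting 0 only matters for the graph without vertices, whose maximum degree
   is taken to be 0; the empty vertex set is thus p-independent for every p. *)
definition max_degree :: "'a ugraph \<Rightarrow> nat" where
  "max_degree G = Max (insert 0 (degree G ` verts G))"

definition induced_subgraph :: "'a ugraph \<Rightarrow> 'a set \<Rightarrow> 'a ugraph" where
  "induced_subgraph G S = \<lparr>verts = S, edges = {e \<in> edges G. e \<subseteq> S}\<rparr>"

definition p_independent :: "nat \<Rightarrow> 'a ugraph \<Rightarrow> 'a set \<Rightarrow> bool" where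
  "p_independent p G S \<longleftrightarrow> S \<subseteq> verts G \<and> max_degree (induced_subgraph G S) \<le> p"

definition alpha :: "nat \<Rightarrow> 'a ugraph \<Rightarrow> nat" where
  "alpha p G = Max (card ` {S. p_independent p G S})"

definition line_graph :: "'a ugraph \<Rightarrow> 'a set ugraph" where
  "line_graph G =
     \<lparr>verts = edges G,
      edges = {{e, f} | e f. e \<in> edges G \<and> f \<in> edges G \<and> e \<noteq> f \<and> e \<inter> f \<noteq> {}}\<rparr>"

lemma finite_simple_graph_line_graph:
  assumes "finite_simple_graph G"
  shows "finite_simple_graph (line_graph G)"
proof -
  have "edges G \<subseteq> Pow (verts G)"
    using assms by (auto simp: finite_simple_graph_def simple_graph_def)
  then have "finite (edges G)"
    using assms by (meson finite_Pow_iff finite_simple_graph_def finite_subset)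
  then show ?thesis
    by (auto simp: finite_simple_graph_def simple_graph_def line_graph_def card_2_iff)
qed

lemma max_degree_le_iff:
  assumes "finite (verts G)"
  shows "max_degree G \<le> p \<longleftrightarrow> (\<forall>v \<in> verts G. degree G v \<le> p)"
  using assms by (simp add: max_degree_def)

(* The maximum in alpha ranges over a finite nonempty set, so it is attained. *)
lemma alpha_attained:
  assumes "finite (verts G)"
  shows "\<exists>S. p_independent p G S \<and> card S = alpha p G"
    and "\<And>S. p_independent p G S \<Longrightarrow> card S \<le> alpha p G"
proof -
  have fin: "finite {S. p_independent p G S}"
    by (rule finite_subset[of _ "Pow (verts G)"]) (auto simp: p_independent_def assms)
  have "p_independent p G {}"
    by (simp add: p_independent_def max_degree_def induced_subgraph_def)
  then have "alpha p G \<in> card ` {S. p_independent p G S}"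
    unfolding alpha_def using fin by (intro Max_in) auto
  then show "\<exists>S. p_independent p G S \<and> card S = alpha p G" by auto
  show "\<And>S. p_independent p G S \<Longrightarrow> card S \<le> alpha p G"
    unfolding alpha_def using fin by (intro Max_ge) auto
qed

end

theory Submission
  imports Defs
begin

text \<open>
  It suffices to find \<open>|V|\<close> edges of which each meets at most three others.
  A graph whose degrees lie in \<open>{k, k + 1}\<close>, once it is edge-minimal with minimum degree \<open>k\<close>,
  has no two adjacent vertices of degree \<open>k + 1\<close>; by Hall's theorem some matching covers all of
  these vertices, and deleting it leaves degrees in \<open>{k - 1, k}\<close> (Thomassen's proof of Tutte's theorem
  on \<open>[k, k + 1]\<close>-factors). Descending from \<open>r\<close> yields a spanning subgraph with degrees in \<open>{2, 3}\<close>.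
  If it is edge-minimal with minimum degree \<open>2\<close>, every edge has an endpoint of degree \<open>2\<close> and hence
  meets at most \<open>1 + 2\<close> others, while there are at least \<open>|V|\<close> edges by the handshake lemma.
\<close>

section \<open>Hall's marriage theorem\<close>

lemma hall_marriage:
  fixes A :: "'i \<Rightarrow> 'b set"
  assumes "finite I" "\<And>i. i \<in> I \<Longrightarrow> finite (A i)"
    and "\<And>J. J \<subseteq> I \<Longrightarrow> card J \<le> card (\<Union>(A ` J))"
  shows "\<exists>f. inj_on f I \<and> (\<forall>i\<in>I. f i \<in> A i)"
  using assms
proof (induction I arbitrary: A rule: finite_psubset_induct)
  case (psubset I)
  note hall = psubset.prems(2)
  have finU: "finite (\<Union>(A ` J))" if "J \<subseteq> I" for J
    using that psubset.hyps psubset.prems(1) by (meson finite_UN finite_subset subsetD)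
  show ?case
  \<comment> \<open>A tight subfamily \<open>J\<close> is matched inside its union
    \<open>?U\<close>, the remaining indices outside \<open>?U\<close>. The Hall condition for
    \<open>K\<close> in the remainder is that for \<open>K \<union> J\<close> with the equality for
    \<open>J\<close> subtracted.\<close>
  proof (cases "\<exists>J. J \<subset> I \<and> J \<noteq> {} \<and> card (\<Union>(A ` J)) = card J")
    case True
    then obtain J where J: "J \<subset> I" "J \<noteq> {}" "card (\<Union>(A ` J)) = card J"
      by blast
    let ?U = "\<Union>(A ` J)"
    have finJ: "finite J" and JI: "J \<subseteq> I"
      using J psubset.hyps by (auto intro: finite_subset)
    have "\<exists>f. inj_on f J \<and> (\<forall>i\<in>J. f i \<in> A i)"
      using J hall psubset.prems(1) by (intro psubset.IH) auto
    then obtain f where f: "inj_on f J" "\<And>i. i \<in> J \<Longrightarrow> f i \<in> A i"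
      by blast
    have "\<exists>g. inj_on g (I - J) \<and> (\<forall>i\<in>I - J. g i \<in> A i - ?U)"
    proof (rule psubset.IH)
      show "I - J \<subset> I"
        using J by blast
      show "finite (A i - ?U)" if "i \<in> I - J" for i
        using that psubset.prems(1) by blast
      show "card K \<le> card (\<Union>i\<in>K. A i - ?U)" if K: "K \<subseteq> I - J" for K
      proof -
        have finK: "finite K"
          using K psubset.hyps by (meson finite_Diff finite_subset)
        have "card K + card J = card (K \<union> J)"
          using K finK finJ by (subst card_Un_disjoint) auto
        also have "\<dots> \<le> card (\<Union>(A ` (K \<union> J)))"
          using K JI by (intro hall) auto
        also have "\<Union>(A ` (K \<union> J)) = (\<Union>i\<in>K. A i - ?U) \<union> ?U"
          by auto
        also have "card \<dots> \<le> card (\<Union>i\<in>K. A i - ?U) + card ?U"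
          by (rule card_Un_le)
        finally show ?thesis
          using J(3) by simp
      qed
    qed
    then obtain g where g: "inj_on g (I - J)" "\<And>i. i \<in> I - J \<Longrightarrow> g i \<in> A i - ?U"
      by blast
    let ?h = "\<lambda>i. if i \<in> J then f i else g i"
    have sep: "f i \<noteq> g j" if "i \<in> J" "j \<in> I - J" for i j
      using f(2)[OF that(1)] g(2)[OF that(2)] that(1) by auto
    have "inj_on ?h I"
    proof (rule inj_onI)
      fix x y assume "x \<in> I" "y \<in> I" "?h x = ?h y"
      then show "x = y"
        using inj_onD[OF f(1), of x y] inj_onD[OF g(1), of x y] sep[of x y] sep[of y x]
        by (cases "x \<in> J"; cases "y \<in> J") auto
    qed
    moreover have "\<forall>i\<in>I. ?h i \<in> A i"
      using f(2) g(2) by auto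
    ultimately show ?thesis
      by blast
  next
    case False
    show ?thesis
    proof (cases "I = {}")
      case True
      then show ?thesis
        by simp
    next
      case nonempty: False
      then obtain i where i: "i \<in> I"
        by blast
      have "A i \<noteq> {}"
        using hall[of "{i}"] i by auto
      then obtain x where x: "x \<in> A i"
        by blast
      \<comment> \<open>Without a tight subfamily, each nonempty \<open>K\<close> that omits
        \<open>i\<close> has at least one element to spare, so giving \<open>x\<close> to
        \<open>i\<close> preserves the Hall condition.\<close>
      have "\<exists>g. inj_on g (I - {i}) \<and> (\<forall>j\<in>I - {i}. g j \<in> A j - {x})"
      proof (rule psubset.IH)
        show "I - {i} \<subset> I"
          using i by blast
        show "finite (A j - {x})" if "j \<in> I - {i}" for j
          using that psubset.prems(1) by blast
        show "card K \<le> card (\<Union>j\<in>K. A j - {x})" if K: "K \<subseteq> I - {i}" for K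
        proof (cases "K = {}")
          case nonempty: False
          have "card (\<Union>(A ` K)) \<noteq> card K"
            using False K nonempty i by blast
          moreover have "card K \<le> card (\<Union>(A ` K))"
            using K by (intro hall) auto
          moreover have "(\<Union>j\<in>K. A j - {x}) = \<Union>(A ` K) - {x}"
            by auto
          moreover have "card (\<Union>(A ` K)) - 1 \<le> card (\<Union>(A ` K) - {x})"
            by (simp add: card_Diff_singleton_if)
          ultimately show ?thesis
            by simp
        qed simp
      qed
      then obtain g where g: "inj_on g (I - {i})" "\<And>j. j \<in> I - {i} \<Longrightarrow> g j \<in> A j - {x}"
        by blast
      have "inj_on (g(i := x)) I"
        using g by (fastforce simp: inj_on_def)
      moreover have "\<forall>j\<in>I. (g(i := x)) j \<in> A j"
        using g(2) x by auto
      ultimately show ?thesis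
        by blast
    qed
  qed
qed

section \<open>Degrees in spanning subgraphs, represented by their edge sets\<close>

definition edeg :: "'a set set \<Rightarrow> 'a \<Rightarrow> nat" where
  "edeg E v = card {e \<in> E. v \<in> e}"

lemma edeg_mono: "finite E \<Longrightarrow> F \<subseteq> E \<Longrightarrow> edeg F v \<le> edeg E v"
  unfolding edeg_def by (rule card_mono) auto

lemma edeg_Diff:
  assumes "finite E" "M \<subseteq> E"
  shows "edeg (E - M) v + edeg M v = edeg E v"
proof -
  have "{e \<in> E. v \<in> e} = {e \<in> E - M. v \<in> e} \<union> {e \<in> M. v \<in> e}"
    using assms(2) by auto
  also have "card \<dots> = card {e \<in> E - M. v \<in> e} + card {e \<in> M. v \<in> e}"
    using assms by (intro card_Un_disjoint) (auto intro: finite_subset)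
  finally show ?thesis
    by (simp add: edeg_def)
qed

lemma sum_edeg:
  assumes "finite V" "finite E" "\<And>e. e \<in> E \<Longrightarrow> e \<subseteq> V \<and> card e = 2"
  shows "(\<Sum>v\<in>V. edeg E v) = 2 * card E"
proof -
  have "(\<Sum>v\<in>V. edeg E v) = (\<Sum>v\<in>V. \<Sum>e\<in>E. if v \<in> e then 1 else 0)"
    using assms(2) by (simp add: edeg_def sum.If_cases Int_def)
  also have "\<dots> = (\<Sum>e\<in>E. \<Sum>v\<in>V. if v \<in> e then 1 else 0)"
    by (rule sum.swap)
  also have "\<dots> = (\<Sum>e\<in>E. 2)"
  proof (rule sum.cong[OF refl])
    fix e assume "e \<in> E"
    then have "V \<inter> e = e" "card e = 2"
      using assms(3) by auto
    then show "(\<Sum>v\<in>V. if v \<in> e then 1 else 0) = (2 :: nat)"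
      using assms(1) by (simp add: sum.If_cases)
  qed
  finally show ?thesis
    by simp
qed

text \<open>A subset of least cardinality that keeps the degree bound works: deleting one of its
  edges breaks the bound at some vertex, and since a single edge changes a degree by at most one,
  and only at its ends, that vertex lies on the edge and has degree exactly
  \<open>k\<close>.\<close>

lemma edge_minimal_min_degree:
  assumes "finite E" "\<And>v. v \<in> V \<Longrightarrow> k \<le> edeg E v"
  obtains F where "F \<subseteq> E" "\<And>v. v \<in> V \<Longrightarrow> k \<le> edeg F v"
    "\<And>e. e \<in> F \<Longrightarrow> \<exists>v\<in>e. edeg F v = k"
proof -
  let ?P = "\<lambda>F. F \<subseteq> E \<and> (\<forall>v\<in>V. k \<le> edeg F v)"
  have "?P E"
    using assms(2) by blast
  then obtain F where F: "?P F" and min: "\<And>F'. ?P F' \<Longrightarrow> card F \<le> card F'"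
    using ex_has_least_nat[of ?P E card] by blast
  have finF: "finite F"
    using F assms(1) finite_subset by blast
  have "\<exists>v\<in>e. edeg F v = k" if e: "e \<in> F" for e
  proof -
    have "card (F - {e}) < card F"
      using finF e by (rule card_Diff1_less)
    then have "\<not> ?P (F - {e})"
      using min not_le by blast
    then obtain v where v: "v \<in> V" "edeg (F - {e}) v < k"
      using F by (auto simp: not_le)
    have eq: "edeg (F - {e}) v + edeg {e} v = edeg F v"
      using finF e by (intro edeg_Diff) auto
    have "{f \<in> {e}. v \<in> f} = (if v \<in> e then {e} else {})"
      by auto
    then have "edeg {e} v = (if v \<in> e then 1 else 0)"
      by (simp add: edeg_def)
    moreover have "k \<le> edeg F v"
      using F v(1) by blast
    ultimately have "v \<in> e \<and> edeg F v = k"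
      using eq v(2) by (auto split: if_splits)
    then show ?thesis
      by blast
  qed
  then show thesis
    using that F by blast
qed

section \<open>Factors with two consecutive degrees\<close>

lemma factor_step:
  assumes finV: "finite V" and E: "\<And>e. e \<in> E \<Longrightarrow> e \<subseteq> V \<and> card e = 2"
    and deg: "\<And>v. v \<in> V \<Longrightarrow> edeg E v \<in> {Suc k, Suc (Suc k)}"
  shows "\<exists>F\<subseteq>E. \<forall>v\<in>V. edeg F v \<in> {k, Suc k}"
proof -
  have finE: "finite E"
    using E by (intro finite_subset[OF _ finite_Pow_iff[THEN iffD2, OF finV]]) auto
  obtain F where FE: "F \<subseteq> E" and lower: "\<And>v. v \<in> V \<Longrightarrow> Suc k \<le> edeg F v"
    and min: "\<And>e. e \<in> F \<Longrightarrow> \<exists>v\<in>e. edeg F v = Suc k"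
    by (rule edge_minimal_min_degree[of E V "Suc k"]) (use finE deg in force)+
  have finF: "finite F"
    using FE finE finite_subset by blast
  have upper: "edeg F v \<le> Suc (Suc k)" if "v \<in> V" for v
    using edeg_mono[OF finE FE, of v] deg[OF that] by auto
  define A where "A = {v \<in> V. edeg F v = Suc (Suc k)}"
  define N where "N v = {u. {v, u} \<in> F}" for v
  have edgeF: "\<exists>u. e = {v, u}" if "e \<in> F" "v \<in> e" for e v
  proof -
    have "card e = 2"
      using that FE E by auto
    then show ?thesis
      using that(2) by (auto simp: card_2_iff)
  qed
  \<comment> \<open>By minimality an edge at a vertex of \<open>A\<close> must have its other end of
    degree \<open>Suc k\<close>; in particular \<open>A\<close> is independent in
    \<open>F\<close>.\<close>
  have N: "u \<in> V \<and> u \<notin> A \<and> edeg F u = Suc k" if "v \<in> A" "u \<in> N v" for u v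
  proof -
    have "{v, u} \<in> F"
      using that by (simp add: N_def)
    then have "u \<in> V" "edeg F v = Suc k \<or> edeg F u = Suc k"
      using FE E min by blast+
    then show ?thesis
      using that(1) by (auto simp: A_def)
  qed
  have "\<exists>f. inj_on f A \<and> (\<forall>v\<in>A. f v \<in> N v)"
  proof (rule hall_marriage)
    show "finite A"
      using finV by (simp add: A_def)
    show "finite (N v)" if "v \<in> A" for v
      using N that finV by (blast intro: finite_subset)
    show "card J \<le> card (\<Union>(N ` J))" if J: "J \<subseteq> A" for J
    proof -
      let ?inc = "\<lambda>v. {e \<in> F. v \<in> e}"
      have finJ: "finite J"
        using J finV by (auto simp: A_def intro: finite_subset)
      have disjoint: "?inc v \<inter> ?inc w = {}" if "v \<in> J" "w \<in> J" "v \<noteq> w" for v w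
      proof -
        have False if e: "e \<in> F" "v \<in> e" "w \<in> e" for e
        proof -
          obtain u where "e = {v, u}"
            using edgeF e by blast
          then have "w \<in> N v"
            using e \<open>v \<noteq> w\<close> by (auto simp: N_def)
          then show False
            using N J \<open>v \<in> J\<close> \<open>w \<in> J\<close> by blast
        qed
        then show ?thesis
          by blast
      qed
      \<comment> \<open>Double counting for the Hall condition. No edge of \<open>F\<close> joins
        two vertices of \<open>J\<close>, so exactly \<open>(k + 2) * card J\<close> edges meet
        \<open>J\<close>. All of them end in the neighbourhood of \<open>J\<close>, whose vertices
        have degree \<open>k + 1\<close>.\<close>
      have "Suc (Suc k) * card J = (\<Sum>v\<in>J. edeg F v)"
        using J by (simp add: A_def subset_iff)
      also have "\<dots> = card (\<Union>(?inc ` J))"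
        unfolding edeg_def using finJ finF disjoint by (subst card_UN_disjoint) auto
      also have "\<dots> \<le> card (\<Union>(?inc ` \<Union>(N ` J)))"
      proof (rule card_mono)
        show "finite (\<Union>(?inc ` \<Union>(N ` J)))"
          by (rule finite_subset[OF _ finF]) auto
        show "\<Union>(?inc ` J) \<subseteq> \<Union>(?inc ` \<Union>(N ` J))"
        proof
          fix e assume "e \<in> \<Union>(?inc ` J)"
          then obtain v where v: "v \<in> J" "e \<in> F" "v \<in> e"
            by blast
          then obtain u where "e = {v, u}"
            using edgeF by blast
          then have "u \<in> N v" "u \<in> e"
            using v by (auto simp: N_def)
          then show "e \<in> \<Union>(?inc ` \<Union>(N ` J))"
            using v by blast
        qed
      qed
      also have "\<dots> \<le> (\<Sum>u\<in>\<Union>(N ` J). edeg F u)"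
      proof -
        have "\<Union>(N ` J) \<subseteq> V"
          using N J by blast
        then show ?thesis
          unfolding edeg_def using finV finite_subset by (intro card_UN_le) blast
      qed
      also have "\<dots> = (\<Sum>u\<in>\<Union>(N ` J). Suc k)"
        using N J by (intro sum.cong) auto
      \<comment> \<open>Weakening \<open>k + 1\<close> to \<open>k + 2\<close> gives both sides the
        same positive factor, which then cancels.\<close>
      also have "\<dots> \<le> Suc (Suc k) * card (\<Union>(N ` J))"
        by simp
      finally show ?thesis
        by (simp only: Suc_mult_le_cancel1)
    qed
  qed
  then obtain f where inj: "inj_on f A" and f: "\<And>v. v \<in> A \<Longrightarrow> f v \<in> N v"
    by blast
  \<comment> \<open>\<open>M\<close> is a matching: \<open>f\<close> is injective and takes its
    values outside \<open>A\<close>, so two different edges of \<open>M\<close> share neither kind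
    of endpoint.\<close>
  define M where "M = (\<lambda>v. {v, f v}) ` A"
  have fA: "f v \<notin> A" if "v \<in> A" for v
    using N f that by blast
  have MF: "M \<subseteq> F"
    using f by (auto simp: M_def N_def)
  have diff: "edeg (F - M) v + edeg M v = edeg F v" for v
    using finF MF by (rule edeg_Diff)
  have le1: "edeg M v \<le> 1" for v
  proof -
    have "e = e'" if "e \<in> M" "v \<in> e" "e' \<in> M" "v \<in> e'" for e e'
      using that fA inj by (auto simp: M_def inj_on_def)
    moreover have "finite {e \<in> M. v \<in> e}"
      using finF MF by (auto intro: finite_subset)
    ultimately show ?thesis
      unfolding edeg_def One_nat_def by (subst card_le_Suc0_iff_eq) auto
  qed
  have ge1: "1 \<le> edeg M v" if "v \<in> A" for v
  proof -
    have "{v, f v} \<in> {e \<in> M. v \<in> e}"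
      using that by (simp add: M_def)
    moreover have "finite {e \<in> M. v \<in> e}"
      using finF MF by (auto intro: finite_subset)
    ultimately show ?thesis
      unfolding edeg_def by (metis One_nat_def Suc_leI card_gt_0_iff empty_iff)
  qed
  \<comment> \<open>Vertices of \<open>A\<close> drop from \<open>k + 2\<close> to exactly
    \<open>k + 1\<close>; all others have degree \<open>k + 1\<close> in \<open>F\<close> and lose
    at most one.\<close>
  have "edeg (F - M) v \<in> {k, Suc k}" if v: "v \<in> V" for v
  proof (cases "v \<in> A")
    case True
    then show ?thesis
      using diff[of v] le1[of v] ge1[OF True] by (auto simp: A_def)
  next
    case False
    then have "edeg F v = Suc k"
      using lower[OF v] upper[OF v] v by (auto simp: A_def)
    then show ?thesis
      using diff[of v] le1[of v] by auto
  qed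
  moreover have "F - M \<subseteq> E"
    using FE by blast
  ultimately show ?thesis
    by blast
qed

lemma near_regular_factor:
  assumes "finite V" "\<And>e. e \<in> E \<Longrightarrow> e \<subseteq> V \<and> card e = 2" "k \<le> d"
    and "\<And>v. v \<in> V \<Longrightarrow> edeg E v \<in> {d, Suc d}"
  shows "\<exists>F\<subseteq>E. \<forall>v\<in>V. edeg F v \<in> {k, Suc k}"
  using assms(3)
\<comment> \<open>The induction descends from \<open>d\<close>, as \<open>factor_step\<close> lowers
  both admissible degrees by one.\<close>
proof (induction k rule: inc_induct)
  case base
  then show ?case
    using assms(4) by blast
next
  case (step k)
  then obtain F where F: "F \<subseteq> E" "\<And>v. v \<in> V \<Longrightarrow> edeg F v \<in> {Suc k, Suc (Suc k)}"
    by blast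
  then have "\<exists>F'\<subseteq>F. \<forall>v\<in>V. edeg F' v \<in> {k, Suc k}"
    using assms(1,2) by (intro factor_step) auto
  then show ?case
    using F(1) by blast
qed

section \<open>Edge sets as vertex sets of the line graph\<close>

lemma degree_induced_line_graph_le:
  assumes "finite F" "{a, b} \<in> F"
  shows "degree (induced_subgraph (line_graph G) F) {a, b} \<le> (edeg F a - 1) + (edeg F b - 1)"
proof -
  \<comment> \<open>Each edge of the induced subgraph at \<open>{a, b}\<close> is determined by its
    other end, a further member of \<open>F\<close> through \<open>a\<close> or \<open>b\<close>. As
    \<open>{a, b}\<close> itself counts in both degrees, the truncated subtractions of 1 are
    exact.\<close>
  let ?X = "\<lambda>v. {f \<in> F. v \<in> f} - {{a, b}}"
  let ?D = "{x \<in> edges (induced_subgraph (line_graph G) F). {a, b} \<in> x}"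
  have "?D \<subseteq> (\<lambda>f. {{a, b}, f}) ` (?X a \<union> ?X b)"
  proof
    fix x assume "x \<in> ?D"
    then obtain e f where x: "x = {e, f}" "e \<noteq> f" "e \<inter> f \<noteq> {}" "x \<subseteq> F" "{a, b} \<in> x"
      by (auto simp: induced_subgraph_def line_graph_def)
    define g where "g = (if e = {a, b} then f else e)"
    have g: "x = {{a, b}, g}" "g \<noteq> {a, b}" "{a, b} \<inter> g \<noteq> {}"
      using x by (auto simp: g_def)
    then have "g \<in> ?X a \<union> ?X b"
      using x(4) by blast
    then show "x \<in> (\<lambda>f. {{a, b}, f}) ` (?X a \<union> ?X b)"
      using g(1) by blast
  qed
  then have "card ?D \<le> card (?X a \<union> ?X b)"
    using assms(1) by (intro surj_card_le) auto
  also have "\<dots> \<le> card (?X a) + card (?X b)"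
    by (rule card_Un_le)
  also have "\<dots> = (edeg F a - 1) + (edeg F b - 1)"
    using assms by (simp add: edeg_def)
  finally show ?thesis
    by (simp add: degree_def)
qed

theorem theorem9:
  fixes G :: "'a ugraph" and r q p :: nat
  assumes "finite_simple_graph G"
    and "regular r G"
    and "r \<ge> 2"
    and "q \<ge> 3"
  shows "alpha p G \<le> alpha q (line_graph G)"
proof -
  let ?V = "verts G"
  have finV: "finite ?V" and E: "\<And>e. e \<in> edges G \<Longrightarrow> e \<subseteq> ?V \<and> card e = 2"
    using assms(1) by (auto simp: finite_simple_graph_def simple_graph_def)
  have finE: "finite (edges G)"
    using finite_simple_graph_line_graph[OF assms(1)]
    by (simp add: finite_simple_graph_def line_graph_def)
  \<comment> \<open>An \<open>r\<close>-regular graph has its degrees in \<open>{r, Suc r}\<close>,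
    so the descent can start at \<open>d = r\<close>.\<close>
  have "\<exists>F\<subseteq>edges G. \<forall>v\<in>?V. edeg F v \<in> {2, Suc 2}"
    using finV E assms(3)
  proof (rule near_regular_factor)
    show "edeg (edges G) v \<in> {r, Suc r}" if "v \<in> ?V" for v
      using that assms(2) by (simp add: regular_def degree_def edeg_def)
  qed
  then obtain H where H: "H \<subseteq> edges G" "\<And>v. v \<in> ?V \<Longrightarrow> edeg H v \<in> {2, 3}"
    by auto
  have finH: "finite H"
    using H(1) finE finite_subset by blast
  \<comment> \<open>A second minimisation, now with bound 2: it rules out edges with both ends of
    degree 3, while the upper bound 3 survives the deletion of edges.\<close>
  obtain F where F: "F \<subseteq> H" "\<And>v. v \<in> ?V \<Longrightarrow> 2 \<le> edeg F v"
      "\<And>e. e \<in> F \<Longrightarrow> \<exists>v\<in>e. edeg F v = 2"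
    by (rule edge_minimal_min_degree[of H ?V 2]) (use finH H in force)+
  have FE: "F \<subseteq> edges G" and finF: "finite F"
    using F(1) H(1) finH finite_subset by auto
  have upper: "edeg F v \<le> 3" if "v \<in> ?V" for v
    using edeg_mono[OF finH F(1), of v] H(2)[OF that] by auto
  have "degree (induced_subgraph (line_graph G) F) e \<le> q" if e: "e \<in> F" for e
  proof -
    obtain a where a: "a \<in> e" "edeg F a = 2"
      using F(3)[OF e] by blast
    have "card e = 2" "e \<subseteq> ?V"
      using e FE E by auto
    then obtain b where b: "e = {a, b}" "b \<in> ?V"
      using a(1) by (auto simp: card_2_iff)
    have "degree (induced_subgraph (line_graph G) F) e \<le> (edeg F a - 1) + (edeg F b - 1)"
      using degree_induced_line_graph_le[OF finF] e b(1) by blast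
    \<comment> \<open>The end \<open>a\<close> contributes \<open>2 - 1\<close> and the end
      \<open>b\<close> at most \<open>3 - 1\<close>.\<close>
    also have "\<dots> \<le> 3"
      using a(2) upper[OF b(2)] by simp
    finally show ?thesis
      using assms(4) by simp
  qed
  then have "p_independent q (line_graph G) F"
    using FE finF
    by (simp add: p_independent_def max_degree_le_iff)
      (simp add: induced_subgraph_def line_graph_def max_degree_def)
  then have "card F \<le> alpha q (line_graph G)"
    using finE by (intro alpha_attained(2)) (simp_all add: line_graph_def)
  moreover have "card ?V \<le> card F"
  proof -
    have "card ?V * 2 \<le> (\<Sum>v\<in>?V. edeg F v)"
      using sum_bounded_below[of ?V 2 "edeg F"] F(2) by simp
    also have "\<dots> = 2 * card F"
      using finV finF FE E by (intro sum_edeg) auto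
    finally show ?thesis
      by simp
  qed
  \<comment> \<open>Only this trivial bound on \<open>alpha p G\<close> is used, which is why
    \<open>p\<close> may be arbitrary.\<close>
  moreover have "alpha p G \<le> card ?V"
    using alpha_attained(1)[OF finV, of p] finV by (auto simp: p_independent_def dest: card_mono)
  ultimately show ?thesis
    by linarith
qed

end
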